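(* Let $(\Omega,\Sigma,P)$, $\Theta$, $D$, $\{P_\theta\}_{\theta\in D}$, $N$, $X=\{X_n\}_{n\in\mathbb N}$, $S$ be as described in the context; in particular $X$ is $P$-conditionally i.i.d. given $\Theta$ and $P$-conditionally mutually independent of $N$ given $\Theta$, $P_{X_1}(\mathbb N_0)=1$, and $P_N\in\mathbf{Panjer}(a(\Theta),b(\Theta);0)$ with $\mathfrak B(D)$-measurable $a,b:D\to\mathbb R$. Let $g(x):=P(S=x)$. Then the family $\{\rho_x\}_{x\in R_S}$ of probability measures on $\Sigma$ defined by $$\rho_x(A):=\frac{\mathbb E_P[\mathbf 1_A\cdot\mathbf 1_{\{S=x\}}]}{\mathbb E_P[\mathbf 1_{\{S=x\}}]}\quad\text{for any }A\in\Sigma$$ is a regular conditional probability of $P$ over $P_S$ consistent with $S$, and $$g(x)=\begin{cases}\mathbb E_P\big[m_{N\mid\Theta}\big(f_{X_1\mid\Theta}(0)\big)\big], & x=0,\\[2pt] \sum_{y=1}^{x}D_{x,y}\cdot g(x-y), & x\in R_S\setminus\{0\},\end{cases}$$ where $$D_{x,y}:=\mathbb E_{\rho_{x-y}}\Big[\Big(a(\Theta)+\frac{b(\Theta)\cdot y}{x}\Big)\cdot\frac{f_{X_1\mid\Theta}(y)}{1-a(\Theta)\cdot f_{X_1\mid\Theta}(0)}\Big]$$ for any $x\in R_S\setminus\{0\}$ and $y\in\{1,\dots,x\}$. In particular, if $f_{X_1\mid\Theta}(0)=0$ $P$-almost surely, then $$g(x)=\begin{cases}P(N=0), & x=0,\\[2pt]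 \sum_{y=1}^{x}D_{x,y}\cdot g(x-y), & x\in R_S\setminus\{0\},\end{cases}$$ where $D_{x,y}=\mathbb E_{\rho_{x-y}}\Big[\Big(a(\Theta)+\frac{b(\Theta)\cdot y}{x}\Big)\cdot f_{X_1\mid\Theta}(y)\Big]$ for any $x\in R_S\setminus\{0\}$ and $y\in\{1,\dots,x\}$.
   Context: Setting. $(\Omega,\Sigma,P)$ is a probability space; $\mathbb N_0=\{0,1,2,\dots\}$. $N$ is an $\mathbb N_0$-valued random variable; $\Theta$ is a $d$-dimensional random vector with values in $D\subseteq\mathbb R^d$, $\mathfrak B(D)$ is the Borel $\sigma$-algebra of $D$ and $P_\Theta$ the distribution of $\Theta$. $X=\{X_n\}_{n\in\mathbb N}$ is a sequence of nonnegative random variables on $\Omega$, and $S:=\sum_{j=1}^N X_j$ if $N\ge1$, $S:=0$ if $N=0$. $P_Z$ denotes the distribution of a random variable $Z$ under $P$. $R_S\subseteq\mathbb N_0$ is the set of values of $S$, with $P(S=x)>0$ for all $x\in R_S$; $P_S$ is considered on $(R_S,\mathcal P(R_S))$. Regular conditional probabilities. For a probability space $(Y,T,Q)$, a family $\{P_y\}_{y\in Y}$ of probability measures on $\Sigma$ is a regular conditional probability of $P$ over $Q$ if (d1) $y\mapsto P_y(E)$ is $T$-measurable for each $E\in\Sigma$ and (d2) $\int P_y(E)\,Q(dy)=P(E)$ for each $E\in\Sigma$. If $f:\Omega\to Y$ is measurable with $P(f^{-1}[B])=Q(B)$ for all $B\in T$, the family is consistent with $f$ if for each $B\in T$, $P_y(f^{-1}[B])=1$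 for $Q$-almost all $y\in B$. It is assumed that $\{P_\theta\}_{\theta\in D}$ is a regular conditional probability of $P$ over $P_\Theta$ consistent with $\Theta$. Conditional independence. $X$ is $P$-conditionally i.i.d. given $\Theta$: for distinct indices $i_1,\dots,i_n$ and reals $z_1,\dots,z_n$, $P(X_{i_1}\le z_1,\dots,X_{i_n}\le z_n\mid\Theta)=\prod_k P(X_{i_k}\le z_k\mid\Theta)$ $P$-a.s., and $P(F\cap X_k^{-1}[B])=P(F\cap X_m^{-1}[B])$ for all $k,m\in\mathbb N$, $F\in\sigma(\Theta)$ and Borel $B\subseteq\mathbb R$. $X$ is $P$-conditionally mutually independent of $N$ given $\Theta$: the $\sigma$-algebras $\sigma(X)$ and $\sigma(N)$ are $P$-conditionally independent given $\sigma(\Theta)$. Panjer condition. $P_N\in\mathbf{Panjer}(a(\Theta),b(\Theta);0)$ means that for every $n\ge1$, $P(N=n\mid\Theta)=\big(a(\Theta)+\frac{b(\Theta)}{n}\big)P(N=n-1\mid\Theta)$ $P$-a.s. Notation. $f_{X_1\mid\Theta}(x)=f_\Theta(x)$, where $f_\theta(x):=P_\theta(X_1=x)$ for $\theta\in D$ and $x\in\mathbb N_0$; thus $f_{X_1\mid\Theta}(x)=P(X_1=x\mid\Theta)$ $P$-a.s. $m_{N\mid\Theta}(t):=\mathbb E_P[t^N\mid\Theta]=\sum_{n\ge0}P(N=n\mid\Theta)\,t^n$ for $|t|\le1$ (with $0^0=1$), and $m_{N\mid\Theta}(f_{X_1\mid\Theta}(0))$ is this series evaluated at $t=f_{X_1\mid\Theta}(0)$.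 Conventions for well-definedness: $a(\Theta)f_{X_1\mid\Theta}(0)\neq1$ $P$-a.s.; the random variables inside the expectations defining $D_{x,y}$ are $\rho_{x-y}$-integrable; and if $x-y\notin R_S$ (so $g(x-y)=0$) the term $D_{x,y}\cdot g(x-y)$ is read as $0$. *)

theory Defs
  imports "HOL-Probability.Probability"
begin

text \<open>A random vector taking values in a (not necessarily Borel) set \<open>D\<close> is an element of
  \<open>M \<rightarrow>\<^sub>M restrict_space borel D\<close>; the sets of \<open>restrict_space borel D\<close> are the traces on \<open>D\<close> of
  the Borel sets. A sequence indexed by the positive integers is a function \<open>X\<close> on \<open>nat\<close> whose value
  at \<open>0\<close> is never used.\<close>

definition generated_by_seq :: "'a measure \<Rightarrow> (nat \<Rightarrow> 'a \<Rightarrow> real) \<Rightarrow> 'a measure" where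
  "generated_by_seq M X =
     sigma (space M) (\<Union>n\<in>{1..}. {X n -` B \<inter> space M | B. B \<in> sets borel})"

definition cprob :: "'a measure \<Rightarrow> 'a measure \<Rightarrow> 'a set \<Rightarrow> 'a \<Rightarrow> real" where
  "cprob M F A = real_cond_exp M F (indicator A)"

definition regular_cond_prob :: "'a measure \<Rightarrow> 'b measure \<Rightarrow> ('b \<Rightarrow> 'a measure) \<Rightarrow> bool" where
  "regular_cond_prob M Q p \<longleftrightarrow>
     (\<forall>y\<in>space Q. prob_space (p y) \<and> sets (p y) = sets M) \<and>
     (\<forall>E\<in>sets M. (\<lambda>y. measure (p y) E) \<in> borel_measurable Q) \<and>
     (\<forall>E\<in>sets M. (\<integral>y. measure (p y) E \<partial>Q) = measure M E)"

definition consistent_with ::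
    "'a measure \<Rightarrow> 'b measure \<Rightarrow> ('b \<Rightarrow> 'a measure) \<Rightarrow> ('a \<Rightarrow> 'b) \<Rightarrow> bool" where
  "consistent_with M Q p f \<longleftrightarrow>
     f \<in> M \<rightarrow>\<^sub>M Q \<and>
     (\<forall>B\<in>sets Q. emeasure M (f -` B \<inter> space M) = emeasure Q B) \<and>
     (\<forall>B\<in>sets Q. AE y in Q. y \<in> B \<longrightarrow> measure (p y) (f -` B \<inter> space M) = 1)"

text \<open>Below, \<open>F\<close> is the conditioning \<open>\<sigma>\<close>-algebra. A tuple of distinct indices with a tuple of real
  thresholds is a finite index set \<open>I\<close> with a function \<open>z\<close>.\<close>

definition cond_iid :: "'a measure \<Rightarrow> 'a measure \<Rightarrow> (nat \<Rightarrow> 'a \<Rightarrow> real) \<Rightarrow> bool" where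
  "cond_iid M F X \<longleftrightarrow>
     (\<forall>I (z :: nat \<Rightarrow> real). finite I \<and> I \<noteq> {} \<and> I \<subseteq> {1..} \<longrightarrow>
        (AE \<omega> in M. cprob M F {\<omega>'\<in>space M. \<forall>i\<in>I. X i \<omega>' \<le> z i} \<omega> =
                    (\<Prod>i\<in>I. cprob M F {\<omega>'\<in>space M. X i \<omega>' \<le> z i} \<omega>))) \<and>
     (\<forall>k\<ge>1. \<forall>m\<ge>1. \<forall>A\<in>sets F. \<forall>B\<in>sets borel.
        measure M (A \<inter> (X k -` B \<inter> space M)) = measure M (A \<inter> (X m -` B \<inter> space M)))"

definition cond_indep :: "'a measure \<Rightarrow> 'a measure \<Rightarrow> 'a measure \<Rightarrow> 'a measure \<Rightarrow> bool" where
  "cond_indep M F G H \<longleftrightarrow>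
     (\<forall>A\<in>sets G. \<forall>B\<in>sets H.
        AE \<omega> in M. cprob M F (A \<inter> B) \<omega> = cprob M F A \<omega> * cprob M F B \<omega>)"

definition cond_panjer0 ::
    "'a measure \<Rightarrow> 'a measure \<Rightarrow> ('a \<Rightarrow> nat) \<Rightarrow> ('a \<Rightarrow> real) \<Rightarrow> ('a \<Rightarrow> real) \<Rightarrow> bool" where
  "cond_panjer0 M F N \<alpha> \<beta> \<longleftrightarrow>
     (\<forall>n\<ge>1. AE \<omega> in M. cprob M F {\<omega>'\<in>space M. N \<omega>' = n} \<omega> =
        (\<alpha> \<omega> + \<beta> \<omega> / real n) * cprob M F {\<omega>'\<in>space M. N \<omega>' = n - 1} \<omega>)"

text \<open>The conditional probability generating function, as a series: its argument may itself depend
  on \<open>\<omega>\<close>, which the form \<open>real_cond_exp M F (\<lambda>\<omega>. t ^ N \<omega>)\<close> with constant \<open>t\<close> does not allow.\<close>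

definition cond_pgf :: "'a measure \<Rightarrow> 'a measure \<Rightarrow> ('a \<Rightarrow> nat) \<Rightarrow> real \<Rightarrow> 'a \<Rightarrow> real" where
  "cond_pgf M F N t \<omega> = (\<Sum>n. cprob M F {\<omega>'\<in>space M. N \<omega>' = n} \<omega> * t ^ n)"

text \<open>The measure \<open>A \<mapsto> E[1\<^sub>A 1\<^bsub>{S = x}\<^esub>] / E[1\<^bsub>{S = x}\<^esub>]\<close>. It is only meaningful if \<open>S = x\<close> has
  positive probability (otherwise it is the null measure).\<close>

definition cond_on_value :: "'a measure \<Rightarrow> ('a \<Rightarrow> real) \<Rightarrow> real \<Rightarrow> 'a measure" where
  "cond_on_value M S x = measure_of (space M) (sets M)
     (\<lambda>A. ennreal ((\<integral>\<omega>. indicator A \<omega> * indicator {\<omega>'\<in>space M. S \<omega>' = x} \<omega> \<partial>M) /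
                   (\<integral>\<omega>. indicator {\<omega>'\<in>space M. S \<omega>' = x} \<omega> \<partial>M)))"

end

theory Submission
  imports Defs "HOL-Computational_Algebra.Formal_Power_Series"
begin

text \<open>The regular conditional probability turns every almost sure identity between conditional
  probabilities given \<open>\<Theta>\<close> into an identity between probabilities under \<open>P\<^bsub>\<Theta>(\<omega>)\<^esub>\<close>, valid for almost
  all \<open>\<omega>\<close>. For such an \<open>\<omega>\<close> the unconditional compound law applies: with \<open>G = \<Sum>\<^sub>k f\<^sub>k t\<^sup>k\<close> and
  \<open>p\<^sub>n = P\<^bsub>\<Theta>(\<omega>)\<^esub>(N = n)\<close>, the weight of \<open>S = x\<close> is the coefficient of \<open>t\<^sup>x\<close> in \<open>\<Sum>\<^sub>n p\<^sub>n G\<^sup>n\<close>, and the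
  Panjer condition yields a recursion for these coefficients. All factors of the recursion other than
  the weights of \<open>S\<close> are \<open>\<sigma>(\<Theta>)\<close>-measurable, so integrating over \<open>\<omega>\<close> replaces the weight of
  \<open>S = x - y\<close> by the indicator of that event, that is, by \<open>\<rho>\<^bsub>x - y\<^esub>\<close> times \<open>g(x - y)\<close>.\<close>

section \<open>Panjer recursion for the coefficients of a compound power series\<close>

text \<open>The coefficients of \<open>G ^ n\<close> are the weights of the \<open>n\<close>-fold convolution; comparing the
  coefficients of \<open>t\<^sup>x\<close> in \<open>t (G ^ n)' = n t G' G ^ (n - 1)\<close> replaces the exchangeability argument
  \<open>E[X\<^sub>1 | X\<^sub>1 + \<dots> + X\<^sub>n = x] = x / n\<close>.\<close>

lemma fps_power_Suc_panjer:
  fixes G :: "real fps" and \<alpha> \<beta> :: real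
  assumes "x \<ge> 1"
  shows "(\<alpha> + \<beta> / real (Suc n)) * fps_nth (G ^ Suc n) x =
         (\<Sum>y=0..x. (\<alpha> + \<beta> * real y / real x) * fps_nth G y * fps_nth (G ^ n) (x - y))"
proof -
  have "fps_X * fps_deriv (G ^ Suc n) = of_nat (Suc n) * ((fps_X * fps_deriv G) * G ^ n)"
    unfolding fps_deriv_power' by (simp add: algebra_simps)
  from arg_cong[OF this, of "\<lambda>h. fps_nth h x"]
  have deriv: "fps_nth (fps_X * fps_deriv (G ^ Suc n)) x =
      fps_nth (of_nat (Suc n) * ((fps_X * fps_deriv G) * G ^ n)) x" .
  have *: "real x * fps_nth (G ^ Suc n) x =
      real (Suc n) * (\<Sum>y=0..x. real y * fps_nth G y * fps_nth (G ^ n) (x - y))"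
  proof -
    \<comment> \<open>\<open>fps_X * fps_deriv\<close> is the Euler operator: the extra variable
      undoes the index shift of the derivative, so the coefficient at \<open>y\<close> is weighted
      by exactly \<open>y\<close>.\<close>
    have X: "fps_nth (fps_X * fps_deriv h) y = real y * fps_nth h y" for h :: "real fps" and y
      by (cases y) auto
    have c: "fps_nth (of_nat m * h) y = real m * fps_nth h y" for h :: "real fps" and m y
      by (simp add: fps_of_nat[symmetric])
    show ?thesis
      using deriv by (simp only: c X fps_mult_nth[of "fps_X * fps_deriv G"])
  qed
  \<comment> \<open>The \<alpha>-part is the plain convolution of \<open>G\<close> with
    \<open>G ^ n\<close>; in the \<beta>-part the identity \<open>*\<close> cancels \<open>x\<close>
    and leaves \<open>\<beta> / real (Suc n)\<close>.\<close>
  have "(\<Sum>y=0..x. (\<alpha> + \<beta> * real y / real x) * fps_nth G y * fps_nth (G ^ n) (x - y)) =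
      \<alpha> * fps_nth (G ^ Suc n) x +
      \<beta> / real x * (\<Sum>y=0..x. real y * fps_nth G y * fps_nth (G ^ n) (x - y))"
    by (simp add: fps_mult_nth sum_distrib_left sum.distrib algebra_simps)
  also have "(\<Sum>y=0..x. real y * fps_nth G y * fps_nth (G ^ n) (x - y)) =
      real x * fps_nth (G ^ Suc n) x / real (Suc n)"
    unfolding * by (simp del: of_nat_Suc)
  finally show ?thesis
    using assms by (simp add: field_simps del: of_nat_Suc power_Suc)
qed

text \<open>The Panjer relation trades \<open>p (Suc n)\<close> for \<open>p n\<close>, and the
  preceding identity expands \<open>G ^ Suc n\<close> by \<open>G ^ n\<close>, so each sum over
  \<open>n\<close> is again a compound coefficient. The term \<open>y = 0\<close> reproduces the
  unknown with a factor different from 1, so the equation can be solved for it.\<close>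

lemma panjer_recursion_fps:
  fixes G :: "real fps" and p :: "nat \<Rightarrow> real" and \<alpha> \<beta> :: real
  assumes sm: "\<And>k. summable (\<lambda>n. p n * fps_nth (G ^ n) k)"
    and p: "\<And>n. p (Suc n) = (\<alpha> + \<beta> / real (Suc n)) * p n"
    and x: "x \<ge> 1" and nz: "\<alpha> * fps_nth G 0 \<noteq> 1"
  shows "(\<Sum>n. p n * fps_nth (G ^ n) x) =
         (\<Sum>y=1..x. (\<alpha> + \<beta> * real y / real x) * (fps_nth G y / (1 - \<alpha> * fps_nth G 0)) *
            (\<Sum>n. p n * fps_nth (G ^ n) (x - y)))"
proof -
  let ?h = "\<lambda>k. \<Sum>n. p n * fps_nth (G ^ n) k"
  let ?c = "\<lambda>y. (\<alpha> + \<beta> * real y / real x) * fps_nth G y"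
  \<comment> \<open>The term \<open>n = 0\<close> drops out because \<open>G ^ 0 = 1\<close> has
    coefficient 0 at every \<open>x \<ge> 1\<close>.\<close>
  have "?h x = (\<Sum>n. p (Suc n) * fps_nth (G ^ Suc n) x)"
    using suminf_split_head[OF sm[of x]] x by simp
  also have "\<dots> = (\<Sum>n. \<Sum>y=0..x. ?c y * (p n * fps_nth (G ^ n) (x - y)))"
  proof (rule arg_cong[where f = suminf], rule ext)
    fix n
    have "p (Suc n) * fps_nth (G ^ Suc n) x =
        p n * ((\<alpha> + \<beta> / real (Suc n)) * fps_nth (G ^ Suc n) x)"
      unfolding p by simp
    then show "p (Suc n) * fps_nth (G ^ Suc n) x =
        (\<Sum>y=0..x. ?c y * (p n * fps_nth (G ^ n) (x - y)))"
      unfolding fps_power_Suc_panjer[OF x] by (simp add: sum_distrib_left mult_ac)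
  qed
  also have "\<dots> = (\<Sum>y=0..x. ?c y * ?h (x - y))"
    by (subst suminf_sum) (auto intro!: summable_mult sm sum.cong suminf_mult)
  \<comment> \<open>At \<open>y = 0\<close> the \<beta>-part vanishes, which is why only \<alpha>
    appears in the denominator of the recursion.\<close>
  also have "\<dots> = \<alpha> * fps_nth G 0 * ?h x + (\<Sum>y=1..x. ?c y * ?h (x - y))"
    by (subst sum.atLeast_Suc_atMost) auto
  finally have "?h x = (\<Sum>y=1..x. ?c y * ?h (x - y)) / (1 - \<alpha> * fps_nth G 0)"
    using nz by (simp add: field_simps)
  then show ?thesis
    by (simp add: sum_divide_distrib)
qed

section \<open>Conditional probabilities represented by a kernel\<close>

text \<open>In the application \<open>F\<close> is \<sigma>(\<Theta>) and \<open>K \<omega>\<close>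
  is \<open>Pcond (\<Theta> \<omega>)\<close>. A conditional probability \<open>cprob M F E\<close>
  is fixed only up to a null set depending on \<open>E\<close>, whereas each
  \<open>K \<omega>\<close> is a genuine measure, so that countable additivity can be used for one
  \<omega> at a time.\<close>

locale conditional_kernel = prob_space M
  for M :: "'a measure" +
  fixes F :: "'a measure" and K :: "'a \<Rightarrow> 'a measure"
  assumes subalgebra: "subalgebra M F"
    and prob_space_kernel: "\<omega> \<in> space M \<Longrightarrow> prob_space (K \<omega>)"
    and sets_kernel: "\<omega> \<in> space M \<Longrightarrow> sets (K \<omega>) = sets M"
    and kernel_borel_measurable: "E \<in> sets M \<Longrightarrow> (\<lambda>\<omega>. measure (K \<omega>) E) \<in> borel_measurable F"
    and cprob_eq_kernel: "E \<in> sets M \<Longrightarrow> AE \<omega> in M. cprob M F E \<omega> = measure (K \<omega>) E"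
begin

sublocale sigma_finite_subalgebra M F
proof -
  interpret finite_measure_subalgebra M F
    by unfold_locales (rule subalgebra)
  show "sigma_finite_subalgebra M F"
    by (rule sigma_finite_subalgebra_axioms)
qed

lemma kernel_borel_measurable' [measurable]:
  "E \<in> sets M \<Longrightarrow> (\<lambda>\<omega>. measure (K \<omega>) E) \<in> borel_measurable M"
  by (rule measurable_from_subalg[OF subalgebra kernel_borel_measurable])

text \<open>Kernel values are versions of conditional probabilities, so an
  \<open>F\<close>-measurable factor can be pulled through. Integrability is asked of the product
  with \<open>indicator E\<close>, as the weights of the recursion are controlled only on events
  \<open>S = x - y\<close>.\<close>

lemma integral_kernel:
  assumes "w \<in> borel_measurable F" "E \<in> sets M"
    and int: "integrable M (\<lambda>\<omega>. w \<omega> * indicator E \<omega>)"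
  shows "integrable M (\<lambda>\<omega>. w \<omega> * measure (K \<omega>) E)"
    and "(\<integral>\<omega>. w \<omega> * measure (K \<omega>) E \<partial>M) = (\<integral>\<omega>. w \<omega> * indicator E \<omega> \<partial>M)"
proof -
  have [measurable]: "E \<in> sets M" "w \<in> borel_measurable M"
    using assms measurable_from_subalg[OF subalgebra] by auto
  have ae: "AE \<omega> in M. w \<omega> * real_cond_exp M F (indicator E) \<omega> = w \<omega> * measure (K \<omega>) E"
    using cprob_eq_kernel[OF assms(2)] unfolding cprob_def by auto
  note intg = real_cond_exp_intg[OF int assms(1)]
  show "integrable M (\<lambda>\<omega>. w \<omega> * measure (K \<omega>) E)"
    using intg(1) by (subst integrable_cong_AE[OF _ _ AE_symmetric[OF ae]]) auto
  show "(\<integral>\<omega>. w \<omega> * measure (K \<omega>) E \<partial>M) = (\<integral>\<omega>. w \<omega> * indicator E \<omega> \<partial>M)"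
    using intg(2) by (subst integral_cong_AE[OF _ _ AE_symmetric[OF ae]]) auto
qed

text \<open>Uniqueness of conditional expectations: by the hypothesis, the kernel weight of
  \<open>E'\<close> is also a version of the conditional probability of \<open>E\<close>.\<close>

lemma kernel_eqI:
  assumes [measurable]: "E \<in> sets M" "E' \<in> sets M"
    and eq: "\<And>A. A \<in> sets F \<Longrightarrow> measure M (A \<inter> E) = measure M (A \<inter> E')"
  shows "AE \<omega> in M. measure (K \<omega>) E = measure (K \<omega>) E'"
proof -
  have "AE \<omega> in M. real_cond_exp M F (indicator E) \<omega> = measure (K \<omega>) E'"
  proof (rule real_cond_exp_charact)
    fix A assume A: "A \<in> sets F"
    then have [measurable]: "A \<in> sets M"
      using subalgebra by (auto simp: subalgebra_def)
    have i: "integrable M (\<lambda>\<omega>. indicator A \<omega> * indicator E' \<omega> :: real)"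
      by (intro integrable_const_bound[where B = 1]) (auto simp: indicator_def)
    have "(\<integral>\<omega>\<in>A. indicator E \<omega> \<partial>M) = measure M (A \<inter> E)"
      by (simp add: set_lebesgue_integral_def indicator_inter_arith[symmetric])
    also have "\<dots> = (\<integral>\<omega>. indicator A \<omega> * indicator E' \<omega> \<partial>M)"
      by (simp add: eq[OF A] indicator_inter_arith[symmetric])
    also have "\<dots> = (\<integral>\<omega>\<in>A. measure (K \<omega>) E' \<partial>M)"
      using integral_kernel(2)[OF _ assms(2) i] A by (simp add: set_lebesgue_integral_def)
    finally show "(\<integral>\<omega>\<in>A. indicator E \<omega> \<partial>M) = (\<integral>\<omega>\<in>A. measure (K \<omega>) E' \<partial>M)" .
  next
    show "integrable M (\<lambda>\<omega>. measure (K \<omega>) E')"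
      using integral_kernel(1)[of "\<lambda>_. 1" E'] by (simp add: integrable_indicator_iff less_top[symmetric])
  qed (auto intro: kernel_borel_measurable simp: integrable_indicator_iff less_top[symmetric])
  with cprob_eq_kernel[OF assms(1)] show ?thesis
    unfolding cprob_def by auto
qed

text \<open>Allows events to be rewritten under the kernel by facts that hold only almost surely
  under \<open>M\<close>, such as integrality of the \<open>X i\<close>. The exceptional set may
  depend on the pair of events.\<close>

lemma kernel_cong_AE:
  assumes [measurable]: "E \<in> sets M" "E' \<in> sets M"
    and ae: "AE \<omega> in M. \<omega> \<in> E \<longleftrightarrow> \<omega> \<in> E'"
  shows "AE \<omega> in M. measure (K \<omega>) E = measure (K \<omega>) E'"
proof (rule kernel_eqI)
  fix A assume "A \<in> sets F"
  then have [measurable]: "A \<in> sets M"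
    using subalgebra by (auto simp: subalgebra_def)
  show "measure M (A \<inter> E) = measure M (A \<inter> E')"
    by (rule measure_eq_AE) (use ae in auto)
qed auto

lemma kernel_Un_disjoint:
  assumes "\<omega> \<in> space M" "A \<in> sets M" "B \<in> sets M" "A \<inter> B = {}"
  shows "measure (K \<omega>) (A \<union> B) = measure (K \<omega>) A + measure (K \<omega>) B"
proof -
  interpret K: prob_space "K \<omega>" by (rule prob_space_kernel) fact
  show ?thesis
    using assms by (intro K.finite_measure_Union) (auto simp: sets_kernel)
qed

section \<open>Conditionally i.i.d. integer variables and compound sums\<close>

text \<open>The hypothesis of conditional independence speaks of the events \<open>X\<^sub>i \<le> z\<^sub>i\<close>; the induction
  turns them into \<open>X\<^sub>i = z\<^sub>i\<close> one index at a time. Thresholds are integers because the step at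
  \<open>z\<^sub>j = 0\<close> uses \<open>z\<^sub>j - 1\<close>.\<close>

lemma kernel_cond_iid_mixed:
  assumes iid: "cond_iid M F X" and X: "\<And>i. i \<ge> 1 \<Longrightarrow> X i \<in> borel_measurable M"
    and nat: "\<And>i. i \<ge> 1 \<Longrightarrow> AE \<omega> in M. X i \<omega> \<in> \<nat>"
    and I: "finite I" "I \<noteq> {}" "I \<subseteq> {1..}" and "J \<subseteq> I"
  shows "AE \<omega> in M.
     measure (K \<omega>) {\<omega>'\<in>space M. (\<forall>i\<in>J. X i \<omega>' = of_int (z i)) \<and> (\<forall>i\<in>I - J. X i \<omega>' \<le> of_int (z i))} =
       (\<Prod>i\<in>J. measure (K \<omega>) {\<omega>'\<in>space M. X i \<omega>' = of_int (z i)}) *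
       (\<Prod>i\<in>I - J. measure (K \<omega>) {\<omega>'\<in>space M. X i \<omega>' \<le> of_int (z i)})"
proof -
  have "finite J" using I(1) \<open>J \<subseteq> I\<close> by (rule rev_finite_subset)
  then show ?thesis using \<open>J \<subseteq> I\<close>
  proof (induction J arbitrary: z)
    case empty
    have Xi [measurable]: "i \<in> I \<Longrightarrow> X i \<in> borel_measurable M" for i
      using X I by auto
    have 1: "AE \<omega> in M. cprob M F {\<omega>'\<in>space M. \<forall>i\<in>I. X i \<omega>' \<le> of_int (z i)} \<omega> =
        (\<Prod>i\<in>I. cprob M F {\<omega>'\<in>space M. X i \<omega>' \<le> of_int (z i)} \<omega>)"
      using iid[unfolded cond_iid_def, THEN conjunct1, rule_format, of I "\<lambda>i. of_int (z i)"] I by simp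
    have 2: "AE \<omega> in M. cprob M F {\<omega>'\<in>space M. \<forall>i\<in>I. X i \<omega>' \<le> of_int (z i)} \<omega> =
        measure (K \<omega>) {\<omega>'\<in>space M. \<forall>i\<in>I. X i \<omega>' \<le> of_int (z i)}"
      using I(1) by (intro cprob_eq_kernel) measurable
    have 3: "AE \<omega> in M. \<forall>i\<in>I. cprob M F {\<omega>'\<in>space M. X i \<omega>' \<le> of_int (z i)} \<omega> =
        measure (K \<omega>) {\<omega>'\<in>space M. X i \<omega>' \<le> of_int (z i)}"
      using I(1) by (intro AE_finite_allI cprob_eq_kernel) measurable
    from 1 2 3 show ?case
      by eventually_elim auto
  next
    case (insert j J)
    have Xi [measurable]: "i \<in> I \<Longrightarrow> X i \<in> borel_measurable M" for i
      using X I by auto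
    have j [measurable]: "j \<in> I" and J: "J \<subseteq> I" "finite J" and jJ: "j \<notin> J"
      using insert by auto
    \<comment> \<open>For integer values, \<open>X j = z j\<close> is \<open>X j \<le> z j\<close>
      without \<open>X j \<le> z j - 1\<close>. The induction hypothesis is used at both thresholds,
      hence the induction over arbitrary \<open>z\<close>.\<close>
    define z' where "z' = z(j := z j - 1)"
    define E where "E J z = {\<omega>'\<in>space M. (\<forall>i\<in>J. X i \<omega>' = of_int (z i)) \<and>
      (\<forall>i\<in>I - J. X i \<omega>' \<le> of_int (z i))}" for J and z :: "nat \<Rightarrow> int"
    have E [measurable]: "E J z \<in> sets M" if "J \<subseteq> I" for J z
    proof -
      have [simp]: "finite J" "finite (I - J)" using that I(1) by (auto intro: finite_subset)
      have [measurable]: "i \<in> J \<Longrightarrow> X i \<in> borel_measurable M" "i \<in> I - J \<Longrightarrow> X i \<in> borel_measurable M"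
        for i using Xi that by auto
      show ?thesis unfolding E_def by measurable
    qed
    have int: "AE \<omega> in M. X j \<omega> \<in> \<int>"
    proof -
      have "AE \<omega> in M. X j \<omega> \<in> \<nat>" using nat j I(3) by auto
      then show ?thesis by eventually_elim (use Nats_subset_Ints in auto)
    qed
    have real_int: "t \<le> of_int k \<longleftrightarrow> t = of_int k \<or> t \<le> of_int (k - 1)"
      if "t \<in> \<int>" for t :: real and k :: int
      using that by (auto elim!: Ints_cases)
    have 1: "AE \<omega> in M. measure (K \<omega>) (E J z) =
        measure (K \<omega>) (E (insert j J) z \<union> E J z')"
    proof (rule kernel_cong_AE)
      show "AE \<omega> in M. \<omega> \<in> E J z \<longleftrightarrow> \<omega> \<in> E (insert j J) z \<union> E J z'"
        using int
      proof eventually_elim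
        case (elim \<omega>)
        have "(\<forall>i\<in>I - J. X i \<omega> \<le> of_int (u i)) \<longleftrightarrow>
            X j \<omega> \<le> of_int (u j) \<and> (\<forall>i\<in>I - insert j J. X i \<omega> \<le> of_int (u i))"
          for u :: "nat \<Rightarrow> int"
          using j jJ by auto
        moreover have "(\<forall>i\<in>J. X i \<omega> = of_int (z' i)) \<longleftrightarrow> (\<forall>i\<in>J. X i \<omega> = of_int (z i))"
          using jJ by (auto simp: z'_def)
        moreover have "(\<forall>i\<in>I - insert j J. X i \<omega> \<le> of_int (z' i)) \<longleftrightarrow>
            (\<forall>i\<in>I - insert j J. X i \<omega> \<le> of_int (z i))"
          by (auto simp: z'_def)
        ultimately show ?case
          using real_int[OF elim, of "z j"] unfolding E_def by (auto simp: z'_def)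
      qed
    qed (use J j in auto)
    have 2: "AE \<omega> in M. measure (K \<omega>) {\<omega>'\<in>space M. X j \<omega>' \<le> of_int (z j)} =
        measure (K \<omega>) ({\<omega>'\<in>space M. X j \<omega>' = of_int (z j)} \<union> {\<omega>'\<in>space M. X j \<omega>' \<le> of_int (z' j)})"
      by (rule kernel_cong_AE) (use int real_int[of "X j _" "z j"] in \<open>auto simp: z'_def\<close>)
    have ih: "AE \<omega> in M. measure (K \<omega>) (E J u) =
       (\<Prod>i\<in>J. measure (K \<omega>) {\<omega>'\<in>space M. X i \<omega>' = of_int (u i)}) *
       (\<Prod>i\<in>I - J. measure (K \<omega>) {\<omega>'\<in>space M. X i \<omega>' \<le> of_int (u i)})" for u
      unfolding E_def by (rule insert.IH) fact
    have "AE \<omega> in M. measure (K \<omega>) (E (insert j J) z) =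
       (\<Prod>i\<in>insert j J. measure (K \<omega>) {\<omega>'\<in>space M. X i \<omega>' = of_int (z i)}) *
       (\<Prod>i\<in>I - insert j J. measure (K \<omega>) {\<omega>'\<in>space M. X i \<omega>' \<le> of_int (z i)})"
      using 1 2 ih[of z] ih[of z'] AE_space
    proof eventually_elim
      case (elim \<omega>)
      have disj: "E (insert j J) z \<inter> E J z' = {}"
      proof -
        have "X j \<omega>' = of_int (z j)" if "\<omega>' \<in> E (insert j J) z" for \<omega>'
          using that by (simp add: E_def)
        moreover have "X j \<omega>' \<le> of_int (z j - 1)" if "\<omega>' \<in> E J z'" for \<omega>'
        proof -
          have "X j \<omega>' \<le> of_int (z' j)" using that j jJ unfolding E_def by blast
          then show ?thesis by (simp add: z'_def)
        qed
        ultimately show ?thesis by fastforce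
      qed
      let ?P = "\<Prod>i\<in>J. measure (K \<omega>) {\<omega>'\<in>space M. X i \<omega>' = of_int (z i)}"
      let ?L = "\<lambda>i t. measure (K \<omega>) {\<omega>'\<in>space M. X i \<omega>' \<le> of_int t}"
      let ?Q = "\<Prod>i\<in>I - insert j J. ?L i (z i)"
      have IJ: "I - J = insert j (I - insert j J)" using j jJ by auto
      have pJ: "(\<Prod>i\<in>J. measure (K \<omega>) {\<omega>'\<in>space M. X i \<omega>' = of_int (z' i)}) = ?P"
        by (rule prod.cong) (use jJ in \<open>auto simp: z'_def\<close>)
      have pQ: "(\<Prod>i\<in>I - insert j J. ?L i (z' i)) = ?Q"
        by (rule prod.cong) (auto simp: z'_def)
      \<comment> \<open>The products for \<open>z\<close> and \<open>z'\<close> differ only in the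
        factor at \<open>j\<close>; after factoring out the rest, the difference of the two
        distribution function values is the point mass at \<open>z j\<close>.\<close>
      have "measure (K \<omega>) (E (insert j J) z) = measure (K \<omega>) (E J z) - measure (K \<omega>) (E J z')"
        using elim(1) kernel_Un_disjoint[OF elim(5) E E disj] J j by auto
      also have "\<dots> = ?P * ?Q * (?L j (z j) - ?L j (z' j))"
        unfolding elim(3,4) IJ pJ using I(1) by (simp add: pQ algebra_simps)
      also have "?L j (z j) - ?L j (z' j) = measure (K \<omega>) {\<omega>'\<in>space M. X j \<omega>' = of_int (z j)}"
        using elim(2) by (subst (asm) kernel_Un_disjoint[OF elim(5)]) (auto simp: z'_def)
      finally show ?case
        using J(2) jJ by (simp add: mult_ac)
    qed
    then show ?case unfolding E_def .
  qed
qed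

text \<open>The mixed statement with \<open>J = I\<close> contains no inequality any more. The
  second clause of \<open>cond_iid\<close>, taken on singletons and lifted to the kernel by
  \<open>kernel_eqI\<close>, then replaces \<open>X i\<close> by \<open>X 1\<close>.\<close>

lemma kernel_cond_iid_nat:
  assumes iid: "cond_iid M F X" and X: "\<And>i. i \<ge> 1 \<Longrightarrow> X i \<in> borel_measurable M"
    and nat: "\<And>i. i \<ge> 1 \<Longrightarrow> AE \<omega> in M. X i \<omega> \<in> \<nat>"
    and I: "finite I" "I \<noteq> {}" "I \<subseteq> {1..}"
  shows "AE \<omega> in M.
     measure (K \<omega>) {\<omega>'\<in>space M. \<forall>i\<in>I. X i \<omega>' = real (z i)} =
       (\<Prod>i\<in>I. measure (K \<omega>) {\<omega>'\<in>space M. X 1 \<omega>' = real (z i)})"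
proof -
  have 1: "AE \<omega> in M. measure (K \<omega>) {\<omega>'\<in>space M. \<forall>i\<in>I. X i \<omega>' = real (z i)} =
      (\<Prod>i\<in>I. measure (K \<omega>) {\<omega>'\<in>space M. X i \<omega>' = real (z i)})"
    using kernel_cond_iid_mixed[OF iid X nat I subset_refl, of "\<lambda>i. int (z i)"] by simp
  have 2: "AE \<omega> in M. \<forall>i\<in>I. measure (K \<omega>) {\<omega>'\<in>space M. X i \<omega>' = real (z i)} =
      measure (K \<omega>) {\<omega>'\<in>space M. X 1 \<omega>' = real (z i)}"
  proof (intro AE_finite_allI kernel_eqI)
    fix i assume i: "i \<in> I"
    have [measurable]: "X i \<in> borel_measurable M" "X 1 \<in> borel_measurable M"
      using X i I by auto
    show "{\<omega>'\<in>space M. X i \<omega>' = real (z i)} \<in> sets M" "{\<omega>'\<in>space M. X 1 \<omega>' = real (z i)} \<in> sets M"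
      by measurable
    fix A assume A: "A \<in> sets F"
    have "measure M (A \<inter> (X i -` {real (z i)} \<inter> space M)) =
        measure M (A \<inter> (X 1 -` {real (z i)} \<inter> space M))"
      using iid[unfolded cond_iid_def, THEN conjunct2, rule_format, of i 1 A "{real (z i)}"] i I A
      by auto
    then show "measure M (A \<inter> {\<omega>'\<in>space M. X i \<omega>' = real (z i)}) =
        measure M (A \<inter> {\<omega>'\<in>space M. X 1 \<omega>' = real (z i)})"
      by (simp add: vimage_def Int_def conj_commute)
  qed (rule I)
  from 1 2 show ?thesis by eventually_elim simp
qed

text \<open>Up to a null set, the event splits into disjoint events that prescribe all values
  \<open>X 1, ..., X n\<close>, one for each list of naturals of length \<open>n\<close> and sum
  \<open>x\<close>. The coefficient of a power of a series expands over the same lists.\<close>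

lemma kernel_partial_sum:
  assumes iid: "cond_iid M F X" and X: "\<And>i. i \<ge> 1 \<Longrightarrow> X i \<in> borel_measurable M"
    and nat: "\<And>i. i \<ge> 1 \<Longrightarrow> AE \<omega> in M. X i \<omega> \<in> \<nat>"
  shows "AE \<omega> in M. measure (K \<omega>) {\<omega>'\<in>space M. (\<Sum>j=1..n. X j \<omega>') = real x} =
     fps_nth (Abs_fps (\<lambda>k. measure (K \<omega>) {\<omega>'\<in>space M. X 1 \<omega>' = real k}) ^ n) x"
proof (cases n)
  case 0
  \<comment> \<open>The list expansion is used for positive exponents, so the empty sum is treated
    apart: the event is everything or nothing, in accordance with \<open>G ^ 0 = 1\<close>.\<close>
  have "measure (K \<omega>) {\<omega>'\<in>space M. (\<Sum>j=1..n. X j \<omega>') = real x} = (if x = 0 then 1 else 0)"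
    if "\<omega> \<in> space M" for \<omega>
    using prob_space.prob_space[OF prob_space_kernel[OF that]]
      sets_eq_imp_space_eq[OF sets_kernel[OF that]] 0 by auto
  then show ?thesis using 0 by (intro AE_I2) auto
next
  case (Suc m)
  \<comment> \<open>\<open>natpermute x n\<close> is the set of lists of \<open>n\<close> naturals
    with sum \<open>x\<close>. List positions start at 0 and the variables at 1, hence
    \<open>v ! (i - 1)\<close>.\<close>
  define V where "V = natpermute x n"
  have [simp]: "finite V" by (simp add: V_def natpermute_finite)
  have len: "length v = n" "sum_list v = x" if "v \<in> V" for v
    using that by (auto simp: V_def natpermute_def)
  define E where "E v = {\<omega>'\<in>space M. \<forall>i\<in>{1..n}. X i \<omega>' = real (v ! (i - 1))}" for v
  have Xi [measurable]: "i \<in> {1..n} \<Longrightarrow> X i \<in> borel_measurable M" for i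
    using X by auto
  have E [measurable]: "E v \<in> sets M" for v
    unfolding E_def by measurable
  have UnE: "(\<Union>v\<in>V. E v) \<in> sets M"
    by (intro sets.finite_UN) auto
  have Sx: "{\<omega>'\<in>space M. (\<Sum>j=1..n. X j \<omega>') = real x} \<in> sets M"
    by measurable
  have S: "(\<Sum>j=1..n. h j) = (\<Sum>j=0..<n. h (Suc j))" for h :: "nat \<Rightarrow> real"
    using sum.shift_bounds_Suc_ivl[of h 0 n] by (simp add: atLeastLessThanSuc_atLeastAtMost)
  have "AE \<omega> in M. \<forall>i\<in>{1..n}. X i \<omega> \<in> \<nat>"
    using nat by (intro AE_finite_allI) auto
  then have 1: "AE \<omega> in M. measure (K \<omega>) {\<omega>'\<in>space M. (\<Sum>j=1..n. X j \<omega>') = real x} =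
      measure (K \<omega>) (\<Union>v\<in>V. E v)"
  proof (intro kernel_cong_AE)
    assume "AE \<omega> in M. \<forall>i\<in>{1..n}. X i \<omega> \<in> \<nat>"
    then show "AE \<omega> in M. \<omega> \<in> {\<omega>'\<in>space M. (\<Sum>j=1..n. X j \<omega>') = real x} \<longleftrightarrow> \<omega> \<in> (\<Union>v\<in>V. E v)"
    proof eventually_elim
      case (elim \<omega>)
      show ?case
      proof safe
        assume \<omega>: "\<omega> \<in> space M" and eq: "(\<Sum>j=1..n. X j \<omega>) = real x"
        \<comment> \<open>The list is read off from the values at \<omega>; the floor loses nothing
          because they are natural numbers here.\<close>
        define v where "v = map (\<lambda>i. nat \<lfloor>X (Suc i) \<omega>\<rfloor>) [0..<n]"
        have *: "X i \<omega> = real (v ! (i - 1))" if "i \<in> {1..n}" for i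
        proof -
          have "X i \<omega> \<in> \<nat>" using elim that by auto
          moreover have "v ! (i - 1) = nat \<lfloor>X i \<omega>\<rfloor>" using that by (auto simp: v_def)
          ultimately show ?thesis by (auto elim!: Nats_cases)
        qed
        have "real (sum_list v) = (\<Sum>j=0..<n. real (v ! j))"
          by (simp add: sum_list_sum_nth v_def)
        also have "\<dots> = (\<Sum>j=1..n. X j \<omega>)"
          unfolding S by (rule sum.cong) (auto simp: *)
        finally have "v \<in> V" using eq by (auto simp: V_def natpermute_def v_def)
        with * \<omega> show "\<omega> \<in> (\<Union>v\<in>V. E v)" by (auto simp: E_def)
      next
        fix v assume v: "v \<in> V" "\<omega> \<in> E v"
        have "(\<Sum>j=1..n. X j \<omega>) = (\<Sum>j=0..<n. real (v ! j))"
          unfolding S by (rule sum.cong) (use v in \<open>auto simp: E_def\<close>)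
        also have "\<dots> = real x"
          using len[OF v(1)] by (simp add: sum_list_sum_nth flip: of_nat_sum)
        finally show "(\<Sum>j=1..n. X j \<omega>) = real x" .
      qed (auto simp: E_def)
    qed
  qed (simp_all only: Sx UnE)
  have 2: "AE \<omega> in M. \<forall>v\<in>V. measure (K \<omega>) (E v) =
      (\<Prod>i\<in>{1..n}. measure (K \<omega>) {\<omega>'\<in>space M. X 1 \<omega>' = real (v ! (i - 1))})"
  proof (rule AE_finite_allI)
    fix v
    show "AE \<omega> in M. measure (K \<omega>) (E v) =
        (\<Prod>i\<in>{1..n}. measure (K \<omega>) {\<omega>'\<in>space M. X 1 \<omega>' = real (v ! (i - 1))})"
      unfolding E_def using kernel_cond_iid_nat[OF iid X nat, of "{1..n}" "\<lambda>i. v ! (i - 1)"]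
      by (simp add: Suc)
  qed simp
  have disj: "disjoint_family_on E V"
    unfolding disjoint_family_on_def
  proof (intro ballI impI equals0I)
    fix u v \<omega> assume *: "u \<in> V" "v \<in> V" "u \<noteq> v" "\<omega> \<in> E u \<inter> E v"
    have "u ! i = v ! i" if "i < n" for i
    proof -
      have "\<forall>j\<in>{1..n}. X j \<omega> = real (u ! (j - 1)) \<and> X j \<omega> = real (v ! (j - 1))"
        using *(4) unfolding E_def by blast
      from bspec[OF this, of "Suc i"] have "X (Suc i) \<omega> = real (u ! i)" "X (Suc i) \<omega> = real (v ! i)"
        using that by simp_all
      then show ?thesis by simp
    qed
    then have "u = v" using len[OF *(1)] len[OF *(2)] by (intro nth_equalityI) auto
    with * show False by simp
  qed
  show ?thesis
    using 1 2 AE_space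
  proof eventually_elim
    case (elim \<omega>)
    interpret K: prob_space "K \<omega>" by (rule prob_space_kernel) fact
    have "measure (K \<omega>) (\<Union>v\<in>V. E v) = (\<Sum>v\<in>V. measure (K \<omega>) (E v))"
      by (rule K.finite_measure_finite_Union) (use disj in \<open>simp_all add: sets_kernel[OF elim(3)] image_subset_iff\<close>)
    also have "\<dots> = (\<Sum>v\<in>V. \<Prod>j\<in>{0..m}. measure (K \<omega>) {\<omega>'\<in>space M. X 1 \<omega>' = real (v ! j)})"
    proof (rule sum.cong)
      fix v assume "v \<in> V"
      have "(\<Prod>i\<in>{1..n}. measure (K \<omega>) {\<omega>'\<in>space M. X 1 \<omega>' = real (v ! (i - 1))}) =
          (\<Prod>j\<in>{0..m}. measure (K \<omega>) {\<omega>'\<in>space M. X 1 \<omega>' = real (v ! j)})"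
        unfolding Suc
        using prod.shift_bounds_cl_Suc_ivl[of "\<lambda>i. measure (K \<omega>) {\<omega>'\<in>space M. X 1 \<omega>' = real (v ! (i - 1))}" 0 m]
        by simp
      with elim \<open>v \<in> V\<close> show "measure (K \<omega>) (E v) =
          (\<Prod>j\<in>{0..m}. measure (K \<omega>) {\<omega>'\<in>space M. X 1 \<omega>' = real (v ! j)})" by simp
    qed simp
    also have "\<dots> = fps_nth (Abs_fps (\<lambda>k. measure (K \<omega>) {\<omega>'\<in>space M. X 1 \<omega>' = real k}) ^ Suc m) x"
      unfolding fps_power_nth_Suc by (simp add: V_def Suc)
    finally show ?case
      using elim(1) unfolding Suc by (simp only:)
  qed
qed

text \<open>On \<open>N = n\<close> the random upper limit of the sum is constant; conditional
  independence factors each such piece, and countable additivity of the kernel adds the pieces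
  up.\<close>

lemma kernel_compound_sum:
  assumes iid: "cond_iid M F X" and X: "\<And>i. i \<ge> 1 \<Longrightarrow> X i \<in> borel_measurable M"
    and nat: "\<And>i. i \<ge> 1 \<Longrightarrow> AE \<omega> in M. X i \<omega> \<in> \<nat>"
    and N [measurable]: "N \<in> M \<rightarrow>\<^sub>M count_space UNIV"
    and indep: "cond_indep M F (generated_by_seq M X) (vimage_algebra (space M) N (count_space UNIV))"
  shows "AE \<omega> in M.
    (\<lambda>n. measure (K \<omega>) {\<omega>'\<in>space M. N \<omega>' = n} *
       fps_nth (Abs_fps (\<lambda>k. measure (K \<omega>) {\<omega>'\<in>space M. X 1 \<omega>' = real k}) ^ n) x)
    sums measure (K \<omega>) {\<omega>'\<in>space M. (\<Sum>j=1..N \<omega>'. X j \<omega>') = real x}"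
proof -
  define T where "T n = {\<omega>'\<in>space M. (\<Sum>j=1..n. X j \<omega>') = real x}" for n
  define C where "C n = {\<omega>'\<in>space M. N \<omega>' = n}" for n
  have [measurable]: "T n \<in> sets M" for n
  proof -
    have [measurable]: "j \<in> {1..n} \<Longrightarrow> X j \<in> borel_measurable M" for j using X by auto
    show ?thesis unfolding T_def by measurable
  qed
  have [measurable]: "C n \<in> sets M" for n
    unfolding C_def by measurable
  \<comment> \<open>Conditional independence concerns \<sigma>(X), so membership in \<open>M\<close>
    is not enough for the partial sum events.\<close>
  have gen: "T n \<in> sets (generated_by_seq M X)" for n
  proof -
    let ?G = "\<Union>n\<in>{1..}. {X n -` B \<inter> space M | B. B \<in> sets borel}"
    have G: "?G \<subseteq> Pow (space M)" by auto
    have [measurable]: "X j \<in> borel_measurable (generated_by_seq M X)" if "j \<in> {1..n}" for j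
    proof (rule measurableI)
      fix B :: "real set" assume "B \<in> sets borel"
      then show "X j -` B \<inter> space (generated_by_seq M X) \<in> sets (generated_by_seq M X)"
        using G that unfolding generated_by_seq_def
        by (auto simp: space_measure_of_conv intro!: sigma_sets.Basic)
    qed auto
    have "{\<omega>'\<in>space (generated_by_seq M X). (\<Sum>j=1..n. X j \<omega>') = real x} \<in> sets (generated_by_seq M X)"
      by measurable
    then show ?thesis
      using G by (simp add: T_def generated_by_seq_def space_measure_of_conv)
  qed
  have "C n \<in> sets (vimage_algebra (space M) N (count_space UNIV))" for n
  proof -
    have "C n = N -` {n} \<inter> space M" by (auto simp: C_def)
    then show ?thesis by (simp add: in_vimage_algebra)
  qed
  then have 1: "AE \<omega> in M. \<forall>n. cprob M F (T n \<inter> C n) \<omega> = cprob M F (T n) \<omega> * cprob M F (C n) \<omega>"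
    using indep gen unfolding cond_indep_def by (auto simp: AE_all_countable)
  have 2: "AE \<omega> in M. \<forall>n. cprob M F (T n \<inter> C n) \<omega> = measure (K \<omega>) (T n \<inter> C n)"
    "AE \<omega> in M. \<forall>n. cprob M F (T n) \<omega> = measure (K \<omega>) (T n)"
    "AE \<omega> in M. \<forall>n. cprob M F (C n) \<omega> = measure (K \<omega>) (C n)"
    unfolding AE_all_countable by (intro allI cprob_eq_kernel; measurable)+
  have 3: "AE \<omega> in M. \<forall>n. measure (K \<omega>) (T n) =
      fps_nth (Abs_fps (\<lambda>k. measure (K \<omega>) {\<omega>'\<in>space M. X 1 \<omega>' = real k}) ^ n) x"
    unfolding AE_all_countable T_def by (intro allI kernel_partial_sum iid X nat)
  show ?thesis
    using 1 2 3 AE_space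
  proof eventually_elim
    case (elim \<omega>)
    interpret K: prob_space "K \<omega>" by (rule prob_space_kernel) fact
    have "(\<lambda>n. measure (K \<omega>) (T n \<inter> C n)) sums measure (K \<omega>) (\<Union>n. T n \<inter> C n)"
      by (rule K.finite_measure_UNION)
        (auto simp: sets_kernel[OF elim(6)] disjoint_family_on_def C_def)
    also have "(\<Union>n. T n \<inter> C n) = {\<omega>'\<in>space M. (\<Sum>j=1..N \<omega>'. X j \<omega>') = real x}"
      by (auto simp: T_def C_def)
    finally have "(\<lambda>n. measure (K \<omega>) (T n \<inter> C n)) sums
        measure (K \<omega>) {\<omega>'\<in>space M. (\<Sum>j=1..N \<omega>'. X j \<omega>') = real x}" .
    moreover have "measure (K \<omega>) (T n \<inter> C n) = measure (K \<omega>) (C n) *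
        fps_nth (Abs_fps (\<lambda>k. measure (K \<omega>) {\<omega>'\<in>space M. X 1 \<omega>' = real k}) ^ n) x" for n
      using elim(1)[rule_format, of n] elim(2)[rule_format, of n] elim(3)[rule_format, of n]
        elim(4)[rule_format, of n] elim(5)[rule_format, of n]
      by (simp only: mult.commute)
    ultimately show ?case
      unfolding C_def by (simp only:)
  qed
qed

text \<open>For almost all \<omega>, the kernel weights satisfy the hypotheses of
  \<open>panjer_recursion_fps\<close> with the constants \<open>\<alpha> \<omega>\<close> and
  \<open>\<beta> \<omega>\<close>.\<close>

lemma kernel_panjer_recursion:
  assumes iid: "cond_iid M F X" and X: "\<And>i. i \<ge> 1 \<Longrightarrow> X i \<in> borel_measurable M"
    and nat: "\<And>i. i \<ge> 1 \<Longrightarrow> AE \<omega> in M. X i \<omega> \<in> \<nat>"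
    and N [measurable]: "N \<in> M \<rightarrow>\<^sub>M count_space UNIV"
    and indep: "cond_indep M F (generated_by_seq M X) (vimage_algebra (space M) N (count_space UNIV))"
    and panjer: "cond_panjer0 M F N \<alpha> \<beta>"
    and nz: "AE \<omega> in M. \<alpha> \<omega> * measure (K \<omega>) {\<omega>'\<in>space M. X 1 \<omega>' = 0} \<noteq> 1"
    and "x \<ge> 1"
  shows "AE \<omega> in M. measure (K \<omega>) {\<omega>'\<in>space M. (\<Sum>j=1..N \<omega>'. X j \<omega>') = real x} =
    (\<Sum>y=1..x. (\<alpha> \<omega> + \<beta> \<omega> * real y / real x) *
       (measure (K \<omega>) {\<omega>'\<in>space M. X 1 \<omega>' = real y} /
         (1 - \<alpha> \<omega> * measure (K \<omega>) {\<omega>'\<in>space M. X 1 \<omega>' = 0})) *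
       measure (K \<omega>) {\<omega>'\<in>space M. (\<Sum>j=1..N \<omega>'. X j \<omega>') = real (x - y)})"
proof -
  define p where "p = (\<lambda>\<omega> n. measure (K \<omega>) {\<omega>'\<in>space M. N \<omega>' = n})"
  define G where "G = (\<lambda>\<omega>. Abs_fps (\<lambda>k. measure (K \<omega>) {\<omega>'\<in>space M. X 1 \<omega>' = real k}))"
  \<comment> \<open>One null set has to serve all \<open>k\<close>, since the recursion links the
    coefficient at \<open>x\<close> with those at all \<open>x - y\<close>.\<close>
  have 1: "AE \<omega> in M. \<forall>k. (\<lambda>n. p \<omega> n * fps_nth (G \<omega> ^ n) k)
      sums measure (K \<omega>) {\<omega>'\<in>space M. (\<Sum>j=1..N \<omega>'. X j \<omega>') = real k}"
    unfolding AE_all_countable p_def G_def by (intro allI kernel_compound_sum iid X nat N indep)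
  have "AE \<omega> in M. \<forall>n. cprob M F {\<omega>'\<in>space M. N \<omega>' = Suc n} \<omega> =
      (\<alpha> \<omega> + \<beta> \<omega> / real (Suc n)) * cprob M F {\<omega>'\<in>space M. N \<omega>' = n} \<omega>"
    unfolding AE_all_countable
  proof
    fix n show "AE \<omega> in M. cprob M F {\<omega>'\<in>space M. N \<omega>' = Suc n} \<omega> =
      (\<alpha> \<omega> + \<beta> \<omega> / real (Suc n)) * cprob M F {\<omega>'\<in>space M. N \<omega>' = n} \<omega>"
      using panjer[unfolded cond_panjer0_def, rule_format, of "Suc n"] by simp
  qed
  moreover have "AE \<omega> in M. \<forall>n. cprob M F {\<omega>'\<in>space M. N \<omega>' = n} \<omega> = p \<omega> n"
    unfolding AE_all_countable p_def by (intro allI cprob_eq_kernel) measurable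
  ultimately have 2: "AE \<omega> in M. \<forall>n. p \<omega> (Suc n) = (\<alpha> \<omega> + \<beta> \<omega> / real (Suc n)) * p \<omega> n"
    by eventually_elim simp
  show ?thesis
    using 1 2 nz
  proof eventually_elim
    case (elim \<omega>)
    have s: "(\<Sum>n. p \<omega> n * fps_nth (G \<omega> ^ n) k) =
        measure (K \<omega>) {\<omega>'\<in>space M. (\<Sum>j=1..N \<omega>'. X j \<omega>') = real k}" for k
      by (rule sums_unique[symmetric, OF elim(1)[rule_format]])
    have "\<alpha> \<omega> * fps_nth (G \<omega>) 0 \<noteq> 1" using elim(3) by (simp add: G_def)
    moreover have "summable (\<lambda>n. p \<omega> n * fps_nth (G \<omega> ^ n) k)" for k
      by (rule sums_summable[OF elim(1)[rule_format]])
    ultimately show ?case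
      using panjer_recursion_fps[of "p \<omega>" "G \<omega>" "\<alpha> \<omega>" "\<beta> \<omega>" x] elim(2) \<open>x \<ge> 1\<close>
      unfolding s by (simp add: G_def)
  qed
qed

end

section \<open>From a regular conditional probability to the kernel\<close>

text \<open>A set A of \<sigma>(\<Theta>) is the preimage of some B. Disintegrating the mass of
  \<open>A \<inter> E\<close> and using consistency gives the integral of
  \<open>measure (p y) E\<close> over B; substituting \<open>\<Theta> \<omega>\<close> for
  \<open>y\<close> makes it an integral over A, as the characterization of conditional expectation
  demands.\<close>

lemma conditional_kernel_regular_cond_prob:
  assumes "prob_space M" and \<Theta>: "\<Theta> \<in> M \<rightarrow>\<^sub>M Q"
    and reg: "regular_cond_prob M (distr M Q \<Theta>) p"
    and cons: "consistent_with M (distr M Q \<Theta>) p \<Theta>"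
  shows "conditional_kernel M (vimage_algebra (space M) \<Theta> Q) (\<lambda>\<omega>. p (\<Theta> \<omega>))"
proof -
  let ?F = "vimage_algebra (space M) \<Theta> Q"
  interpret prob_space M by fact
  note [measurable] = \<Theta>
  have sub: "subalgebra M ?F"
    unfolding subalgebra_def
  proof (intro conjI)
    show "sets ?F \<subseteq> sets M"
      by (rule sets_image_in_sets) (auto simp: \<Theta>)
  qed simp
  then interpret finite_measure_subalgebra M ?F
    by unfold_locales
  have \<Theta>F: "\<Theta> \<in> ?F \<rightarrow>\<^sub>M Q"
    using measurable_space[OF \<Theta>] by (intro measurable_vimage_algebra1) auto
  have p [measurable]: "(\<lambda>y. measure (p y) E) \<in> borel_measurable Q" if "E \<in> sets M" for E
    using reg that unfolding regular_cond_prob_def by auto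
  have pE: "(\<integral>y. measure (p y) E \<partial>distr M Q \<Theta>) = measure M E" if "E \<in> sets M" for E
    using reg that unfolding regular_cond_prob_def by auto
  have pr: "prob_space (p y)" "sets (p y) = sets M" if "y \<in> space Q" for y
    using reg that unfolding regular_cond_prob_def by auto
  have meas: "(\<lambda>\<omega>. measure (p (\<Theta> \<omega>)) E) \<in> borel_measurable ?F" if "E \<in> sets M" for E
    using measurable_compose[OF \<Theta>F p[OF that]] .
  have bnd: "\<bar>measure (p y) E\<bar> \<le> 1" if "y \<in> space Q" for y E
    using prob_space.prob_le_1[OF pr(1)[OF that]] by simp
  show ?thesis
  proof (intro conditional_kernel.intro conditional_kernel_axioms.intro)
    show "prob_space M" "subalgebra M ?F" by fact+
    show "prob_space (p (\<Theta> \<omega>))" "sets (p (\<Theta> \<omega>)) = sets M" if "\<omega> \<in> space M" for \<omega>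
      using pr measurable_space[OF \<Theta> that] by blast+
    show "(\<lambda>\<omega>. measure (p (\<Theta> \<omega>)) E) \<in> borel_measurable ?F" if "E \<in> sets M" for E
      by (rule meas) fact
    fix E assume E [measurable]: "E \<in> sets M"
    show "AE \<omega> in M. cprob M ?F E \<omega> = measure (p (\<Theta> \<omega>)) E"
      unfolding cprob_def
    proof (rule real_cond_exp_charact)
      fix A assume "A \<in> sets ?F"
      then obtain B where A: "A = \<Theta> -` B \<inter> space M" and B [measurable]: "B \<in> sets Q"
        using measurable_space[OF \<Theta>] by (auto simp: sets_vimage_algebra2)
      have [measurable]: "A \<in> sets M" unfolding A by measurable
      have c: "AE y in distr M Q \<Theta>. y \<in> B' \<longrightarrow> measure (p y) (\<Theta> -` B' \<inter> space M) = 1"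
        if "B' \<in> sets Q" for B'
        using cons that unfolding consistent_with_def by auto
      text \<open>Consistency makes the kernel at \<open>y\<close> live on \<open>A\<close> or on its complement, according to
        whether \<open>y \<in> B\<close>.\<close>
      have ae: "AE y in distr M Q \<Theta>. measure (p y) (A \<inter> E) = indicator B y * measure (p y) E"
        using c[OF B] c[OF sets.compl_sets[OF B]] AE_space
      proof eventually_elim
        case (elim y)
        then have y: "y \<in> space Q" by simp
        interpret p: prob_space "p y" using pr(1)[OF y] .
        have [measurable]: "A \<in> sets (p y)" "E \<in> sets (p y)" "\<Theta> -` (space Q - B) \<inter> space M \<in> sets (p y)"
          using pr(2)[OF y] by auto
        show ?case
        proof (cases "y \<in> B")
          case True
          then have "measure (p y) A = 1" using elim unfolding A by simp
          then have "AE \<omega> in p y. \<omega> \<in> A" by (simp add: p.prob_eq_1)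
          then have "measure (p y) (A \<inter> E) = measure (p y) E"
            by (intro measure_eq_AE) auto
          then show ?thesis using True by simp
        next
          case False
          then have "measure (p y) (\<Theta> -` (space Q - B) \<inter> space M) = 1" using elim y by simp
          then have "AE \<omega> in p y. \<omega> \<in> \<Theta> -` (space Q - B) \<inter> space M" by (simp add: p.prob_eq_1)
          then have "AE \<omega> in p y. \<omega> \<notin> A" by eventually_elim (auto simp: A)
          then have "measure (p y) (A \<inter> E) = measure (p y) {}"
            by (intro measure_eq_AE) auto
          then show ?thesis using False by simp
        qed
      qed
      have "(\<integral>\<omega>\<in>A. indicator E \<omega> \<partial>M) = measure M (A \<inter> E)"
        by (simp add: set_lebesgue_integral_def indicator_inter_arith[symmetric])
      also have "\<dots> = (\<integral>y. measure (p y) (A \<inter> E) \<partial>distr M Q \<Theta>)"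
        by (simp add: pE)
      also have "\<dots> = (\<integral>y. indicator B y * measure (p y) E \<partial>distr M Q \<Theta>)"
        by (rule integral_cong_AE) (use ae in auto)
      also have "\<dots> = (\<integral>\<omega>. indicator B (\<Theta> \<omega>) * measure (p (\<Theta> \<omega>)) E \<partial>M)"
        by (rule integral_distr) auto
      also have "\<dots> = (\<integral>\<omega>\<in>A. measure (p (\<Theta> \<omega>)) E \<partial>M)"
        unfolding set_lebesgue_integral_def
        by (rule Bochner_Integration.integral_cong) (auto simp: A indicator_def)
      finally show "(\<integral>\<omega>\<in>A. indicator E \<omega> \<partial>M) = (\<integral>\<omega>\<in>A. measure (p (\<Theta> \<omega>)) E \<partial>M)" .
    next
      show "integrable M (\<lambda>\<omega>. measure (p (\<Theta> \<omega>)) E)"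
        by (rule integrable_const_bound[where B = 1])
          (use bnd measurable_space[OF \<Theta>] in \<open>auto intro!: AE_I2\<close>)
    qed (auto simp: meas integrable_indicator_iff less_top[symmetric])
  qed
qed

section \<open>Conditioning on a value of the compound sum\<close>

text \<open>Both set functions are the same quotient on \<open>sets M\<close>; the identification
  supplies countable additivity, which \<open>measure_of\<close> alone does not. Positivity makes
  the quotient in \<open>ennreal\<close> agree with the real one.\<close>

lemma (in prob_space) cond_on_value_eq_uniform_measure:
  assumes [measurable]: "S \<in> borel_measurable M" and pos: "prob {\<omega>\<in>space M. S \<omega> = x} > 0"
  shows "cond_on_value M S x = uniform_measure M {\<omega>\<in>space M. S \<omega> = x}"
proof -
  let ?E = "{\<omega>\<in>space M. S \<omega> = x}" and ?U = "uniform_measure M {\<omega>\<in>space M. S \<omega> = x}"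
  have E [measurable]: "?E \<in> sets M" by measurable
  have "cond_on_value M S x = measure_of (space M) (sets M) (emeasure ?U)"
    unfolding cond_on_value_def
  proof (rule measure_of_eq)
    fix A assume "A \<in> sigma_sets (space M) (sets M)"
    then have A [measurable]: "A \<in> sets M" by (simp add: sets.sigma_sets_eq)
    have "emeasure ?U A = emeasure M (?E \<inter> A) / emeasure M ?E"
      by (rule emeasure_uniform_measure) auto
    also have "\<dots> = ennreal (prob (A \<inter> ?E) / prob ?E)"
      unfolding emeasure_eq_measure using pos by (subst divide_ennreal) (auto simp: Int_commute)
    finally show "ennreal ((\<integral>\<omega>. indicator A \<omega> * indicator ?E \<omega> \<partial>M) / (\<integral>\<omega>. indicator ?E \<omega> \<partial>M)) =
        emeasure ?U A"
      using sets.sets_into_space[OF A] by (simp add: indicator_inter_arith[symmetric] Int_absorb2 Int_absorb1)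
  qed (rule sets.space_closed)
  also have "\<dots> = ?U"
    using measure_of_of_measure[of ?U] by simp
  finally show ?thesis .
qed

text \<open>The conditioned measure has the normalized indicator as density. The expectation stays
  multiplied by the probability because the summands of the recursion have this shape.\<close>

lemma (in prob_space) cond_on_value_integral:
  fixes w :: "'a \<Rightarrow> real"
  assumes S [measurable]: "S \<in> borel_measurable M" and pos: "prob {\<omega>\<in>space M. S \<omega> = x} > 0"
    and [measurable]: "w \<in> borel_measurable M"
  shows "integrable (cond_on_value M S x) w \<longleftrightarrow>
      integrable M (\<lambda>\<omega>. w \<omega> * indicator {\<omega>\<in>space M. S \<omega> = x} \<omega>)"
    and "(\<integral>\<omega>. w \<omega> \<partial>cond_on_value M S x) * prob {\<omega>\<in>space M. S \<omega> = x} =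
      (\<integral>\<omega>. w \<omega> * indicator {\<omega>\<in>space M. S \<omega> = x} \<omega> \<partial>M)"
proof -
  let ?E = "{\<omega>\<in>space M. S \<omega> = x}"
  have E [measurable]: "?E \<in> sets M" by measurable
  have dens: "cond_on_value M S x = density M (\<lambda>\<omega>. ennreal (indicator ?E \<omega> / prob ?E))"
    unfolding cond_on_value_eq_uniform_measure[OF S pos] uniform_measure_def emeasure_eq_measure
    by (rule density_cong)
      (use pos in \<open>auto simp: divide_ennreal[symmetric] ennreal_indicator\<close>)
  show "integrable (cond_on_value M S x) w \<longleftrightarrow> integrable M (\<lambda>\<omega>. w \<omega> * indicator ?E \<omega>)"
  proof -
    have "integrable (cond_on_value M S x) w \<longleftrightarrow>
        integrable M (\<lambda>\<omega>. (1 / prob ?E) * (w \<omega> * indicator ?E \<omega>))"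
      unfolding dens by (subst integrable_density) (auto simp: mult.commute)
    then show ?thesis
      unfolding integrable_mult_left_iff using pos by auto
  qed
  have "(\<integral>\<omega>. w \<omega> \<partial>cond_on_value M S x) = (\<integral>\<omega>. w \<omega> * indicator ?E \<omega> \<partial>M) / prob ?E"
    unfolding dens by (subst integral_density) (auto simp: mult.commute)
  then show "(\<integral>\<omega>. w \<omega> \<partial>cond_on_value M S x) * prob ?E = (\<integral>\<omega>. w \<omega> * indicator ?E \<omega> \<partial>M)"
    using pos by simp
qed

text \<open>Regularity is the law of total probability over the countably many events
  \<open>S = x\<close>. Consistency holds at every point of \<open>R\<close>, as the conditioned
  measure lives on \<open>S = x\<close>.\<close>

lemma (in prob_space) cond_on_value_regular_consistent:
  assumes S [measurable]: "S \<in> borel_measurable M" and R: "countable R" "S \<in> space M \<rightarrow> R"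
    and pos: "\<And>x. x \<in> R \<Longrightarrow> prob {\<omega>\<in>space M. S \<omega> = x} > 0"
  shows "regular_cond_prob M (distr M (count_space R) S) (cond_on_value M S)"
    and "consistent_with M (distr M (count_space R) S) (cond_on_value M S) S"
proof -
  let ?Q = "distr M (count_space R) S" and ?E = "\<lambda>x. {\<omega>\<in>space M. S \<omega> = x}"
  have E [measurable]: "?E x \<in> sets M" for x by measurable
  have vim: "S -` {x} \<inter> space M = ?E x" for x by auto
  have SR [measurable]: "S \<in> M \<rightarrow>\<^sub>M count_space R"
    using R by (simp add: measurable_count_space_eq_countable vim)
  have em: "emeasure M (?E x) \<noteq> 0" "emeasure M (?E x) \<noteq> \<infinity>" if "x \<in> R" for x
    using pos[OF that] by (auto simp: emeasure_eq_measure)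
  have c: "cond_on_value M S x = uniform_measure M (?E x)" if "x \<in> R" for x
    by (rule cond_on_value_eq_uniform_measure[OF S pos[OF that]])
  have m: "measure (cond_on_value M S x) A = prob (?E x \<inter> A) / prob (?E x)"
    if "x \<in> R" "A \<in> sets M" for x A
    unfolding c[OF that(1)] by (rule measure_uniform_measure) (use em that in auto)
  \<comment> \<open>With a density over the counting measure the integral becomes a sum over
    \<open>R\<close>, in which each weight cancels the denominator of the conditional
    probability.\<close>
  have Q: "?Q = density (count_space R) (\<lambda>x. emeasure M (?E x))"
  proof (rule measure_eqI_countable)
    fix x assume "x \<in> R"
    then show "emeasure ?Q {x} = emeasure (density (count_space R) (\<lambda>x. emeasure M (?E x))) {x}"
      by (simp add: emeasure_distr vim emeasure_density)
  qed (use R in auto)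
  show "regular_cond_prob M ?Q (cond_on_value M S)"
    unfolding regular_cond_prob_def
  proof (intro conjI ballI)
    fix x assume "x \<in> space ?Q"
    then have x: "x \<in> R" by simp
    show "prob_space (cond_on_value M S x)"
      unfolding c[OF x] by (rule prob_space_uniform_measure) (use em[OF x] in auto)
    show "sets (cond_on_value M S x) = sets M"
      unfolding c[OF x] by simp
  next
    fix A assume A [measurable]: "A \<in> sets M"
    show "(\<lambda>x. measure (cond_on_value M S x) A) \<in> borel_measurable ?Q" by simp
    have "(\<integral>\<^sup>+x. ennreal (measure (cond_on_value M S x) A) \<partial>?Q) =
        (\<integral>\<^sup>+x. emeasure M (?E x) * ennreal (measure (cond_on_value M S x) A) \<partial>count_space R)"
      unfolding Q by (subst nn_integral_density) auto
    also have "\<dots> = (\<integral>\<^sup>+x. emeasure M (?E x \<inter> A) \<partial>count_space R)"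
    proof (rule nn_integral_cong)
      fix x assume "x \<in> space (count_space R)"
      then have x: "x \<in> R" by simp
      show "emeasure M (?E x) * ennreal (measure (cond_on_value M S x) A) = emeasure M (?E x \<inter> A)"
        using pos[OF x] by (simp add: m[OF x A] emeasure_eq_measure ennreal_mult'[symmetric])
    qed
    also have "\<dots> = emeasure M (\<Union>x\<in>R. ?E x \<inter> A)"
      by (rule emeasure_UN_countable[symmetric]) (use R in \<open>auto simp: disjoint_family_on_def\<close>)
    also have "(\<Union>x\<in>R. ?E x \<inter> A) = A"
      using R sets.sets_into_space[OF A] by auto
    finally show "(\<integral>x. measure (cond_on_value M S x) A \<partial>?Q) = prob A"
      by (subst integral_eq_nn_integral) (auto simp: measure_def)
  qed
  show "consistent_with M ?Q (cond_on_value M S) S"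
    unfolding consistent_with_def
  proof (intro conjI ballI)
    show "S \<in> M \<rightarrow>\<^sub>M ?Q" by simp
    fix B assume B: "B \<in> sets ?Q"
    then show "emeasure M (S -` B \<inter> space M) = emeasure ?Q B"
      by (simp add: emeasure_distr)
    show "AE x in ?Q. x \<in> B \<longrightarrow> measure (cond_on_value M S x) (S -` B \<inter> space M) = 1"
    proof (intro AE_I2 impI)
      fix x assume "x \<in> space ?Q" "x \<in> B"
      then have "x \<in> R" "?E x \<inter> (S -` B \<inter> space M) = ?E x" by auto
      then show "measure (cond_on_value M S x) (S -` B \<inter> space M) = 1"
        using pos[OF \<open>x \<in> R\<close>] B by (subst m) (auto intro: measurable_sets[OF SR])
    qed
  qed
qed

section \<open>The recursion for the law of the compound sum\<close>

theorem theorem4p1: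
  fixes M :: "'a measure"
    and D :: "(real ^ 'd) set" and \<Theta> :: "'a \<Rightarrow> real ^ 'd"
    and Pcond :: "real ^ 'd \<Rightarrow> 'a measure"
    and N :: "'a \<Rightarrow> nat" and X :: "nat \<Rightarrow> 'a \<Rightarrow> real"
    and a b :: "real ^ 'd \<Rightarrow> real"
    and F :: "'a measure"
    and S :: "'a \<Rightarrow> real" and R :: "real set" and g :: "real \<Rightarrow> real"
    and \<rho> :: "real \<Rightarrow> 'a measure" and f :: "nat \<Rightarrow> 'a \<Rightarrow> real"
    and W :: "nat \<Rightarrow> nat \<Rightarrow> 'a \<Rightarrow> real" and Dxy Dxy0 :: "nat \<Rightarrow> nat \<Rightarrow> real"
  defines "F \<equiv> vimage_algebra (space M) \<Theta> (restrict_space borel D)"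
    and "S \<equiv> \<lambda>\<omega>. \<Sum>j=1..N \<omega>. X j \<omega>"
    and "R \<equiv> S ` space M"
    and "g \<equiv> \<lambda>x. measure M {\<omega>\<in>space M. S \<omega> = x}"
    and "\<rho> \<equiv> cond_on_value M S"
    and "f \<equiv> \<lambda>x \<omega>. measure (Pcond (\<Theta> \<omega>)) {\<omega>'\<in>space M. X 1 \<omega>' = real x}"
    and "W \<equiv> \<lambda>x y \<omega>. (a (\<Theta> \<omega>) + b (\<Theta> \<omega>) * real y / real x) *
                        (f y \<omega> / (1 - a (\<Theta> \<omega>) * f 0 \<omega>))"
    and "Dxy \<equiv> \<lambda>x y. \<integral>\<omega>. W x y \<omega> \<partial>\<rho> (real (x - y))"
    and "Dxy0 \<equiv> \<lambda>x y. \<integral>\<omega>. (a (\<Theta> \<omega>) + b (\<Theta> \<omega>) * real y / real x) * f y \<omega> \<partial>\<rho> (real (x - y))"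
  assumes "prob_space M"
    and "\<Theta> \<in> M \<rightarrow>\<^sub>M restrict_space borel D"
    and "regular_cond_prob M (distr M (restrict_space borel D) \<Theta>) Pcond"
    and "consistent_with M (distr M (restrict_space borel D) \<Theta>) Pcond \<Theta>"
    and "N \<in> M \<rightarrow>\<^sub>M count_space UNIV"
    and "\<And>n. n \<ge> 1 \<Longrightarrow> X n \<in> borel_measurable M"
    and "\<And>n \<omega>. n \<ge> 1 \<Longrightarrow> \<omega> \<in> space M \<Longrightarrow> 0 \<le> X n \<omega>"
    and "R \<subseteq> \<nat>"
    and "\<And>x. x \<in> R \<Longrightarrow> measure M {\<omega>\<in>space M. S \<omega> = x} > 0"
    and "cond_iid M F X"
    and "cond_indep M F (generated_by_seq M X) (vimage_algebra (space M) N (count_space UNIV))"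
    and "measure (distr M borel (X 1)) \<nat> = 1"
    and "a \<in> borel_measurable (restrict_space borel D)"
    and "b \<in> borel_measurable (restrict_space borel D)"
    and "cond_panjer0 M F N (\<lambda>\<omega>. a (\<Theta> \<omega>)) (\<lambda>\<omega>. b (\<Theta> \<omega>))"
    and "AE \<omega> in M. a (\<Theta> \<omega>) * f 0 \<omega> \<noteq> 1"
    and "\<And>x y. real x \<in> R - {0} \<Longrightarrow> y \<in> {1..x} \<Longrightarrow> real (x - y) \<in> R \<Longrightarrow>
           integrable (\<rho> (real (x - y))) (W x y)"
  shows "regular_cond_prob M (distr M (count_space R) S) \<rho> \<and>
     consistent_with M (distr M (count_space R) S) \<rho> S \<and>
     g 0 = (\<integral>\<omega>. cond_pgf M F N (f 0 \<omega>) \<omega> \<partial>M) \<and>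
     (\<forall>x. real x \<in> R - {0} \<longrightarrow> g (real x) =
        (\<Sum>y=1..x. if real (x - y) \<in> R then Dxy x y * g (real (x - y)) else 0)) \<and>
     ((AE \<omega> in M. f 0 \<omega> = 0) \<longrightarrow>
        g 0 = measure M {\<omega>\<in>space M. N \<omega> = 0} \<and>
        (\<forall>x. real x \<in> R - {0} \<longrightarrow> g (real x) =
           (\<Sum>y=1..x. if real (x - y) \<in> R then Dxy0 x y * g (real (x - y)) else 0)))"
proof -
  note \<Theta> = assms(11) and N [measurable] = assms(14) and X = assms(15)
    and pos = assms(18) and iid = assms(19) and indep = assms(20)
  interpret prob_space M by fact
  interpret K: conditional_kernel M F "\<lambda>\<omega>. Pcond (\<Theta> \<omega>)"
    unfolding F_def by (rule conditional_kernel_regular_cond_prob) fact+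
  let ?K = "\<lambda>\<omega>. measure (Pcond (\<Theta> \<omega>))"
  \<comment> \<open>The hypothesis on natural values concerns \<open>X 1\<close>; identical
    distribution, tested on the whole space as a set of \<open>F\<close>, carries it over to every
    \<open>X i\<close>.\<close>
  have nat: "AE \<omega> in M. X i \<omega> \<in> \<nat>" if "i \<ge> 1" for i
  proof -
    have [measurable]: "X i \<in> borel_measurable M" "X 1 \<in> borel_measurable M"
      using X that by auto
    have Nats: "(\<nat> :: real set) \<in> sets borel" by simp
    have "space M \<in> sets F"
      using sets.top[of F] by (simp add: F_def)
    then have "prob (space M \<inter> (X i -` \<nat> \<inter> space M)) = prob (space M \<inter> (X 1 -` \<nat> \<inter> space M))"
      using iid[unfolded cond_iid_def, THEN conjunct2, rule_format, of i 1 "space M" "\<nat>"] that Nats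
      by blast
    then have "prob (X i -` \<nat> \<inter> space M) = 1"
      using assms(21) unfolding measure_distr[OF \<open>X 1 \<in> borel_measurable M\<close> Nats]
      by (simp add: inf_absorb2)
    then have "AE \<omega> in M. \<omega> \<in> X i -` \<nat> \<inter> space M"
      using Nats by (subst (asm) prob_eq_1) auto
    then show ?thesis by eventually_elim auto
  qed
  have S [measurable]: "S \<in> borel_measurable M"
    unfolding S_def
  proof (rule measurable_compose_countable[OF _ N])
    fix n
    have [measurable]: "j \<in> {1..n} \<Longrightarrow> X j \<in> borel_measurable M" for j using X by auto
    show "(\<lambda>\<omega>. \<Sum>j=1..n. X j \<omega>) \<in> borel_measurable M" by measurable
  qed
  define E where "E k = {\<omega>\<in>space M. S \<omega> = real k}" for k :: nat
  have E [measurable]: "E k \<in> sets M" for k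
    unfolding E_def by measurable
  have X1 [measurable]: "X 1 \<in> borel_measurable M" using X by simp
  have fF: "f k \<in> borel_measurable F" for k
    unfolding f_def by (rule K.kernel_borel_measurable) measurable
  have \<Theta>F: "\<Theta> \<in> F \<rightarrow>\<^sub>M restrict_space borel D"
    unfolding F_def using measurable_space[OF \<Theta>] by (intro measurable_vimage_algebra1) auto
  have aF: "(\<lambda>\<omega>. a (\<Theta> \<omega>)) \<in> borel_measurable F" and bF: "(\<lambda>\<omega>. b (\<Theta> \<omega>)) \<in> borel_measurable F"
    using measurable_compose[OF \<Theta>F] assms(22,23) by auto
  have WF: "W x y \<in> borel_measurable F" for x y
    unfolding W_def using aF bF fF by measurable
  note toM = measurable_from_subalg[OF K.subalgebra]
  have [measurable]: "W x y \<in> borel_measurable M" "f k \<in> borel_measurable M"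
    "(\<lambda>\<omega>. a (\<Theta> \<omega>)) \<in> borel_measurable M" "(\<lambda>\<omega>. b (\<Theta> \<omega>)) \<in> borel_measurable M" for x y k
    using toM[OF WF] toM[OF fF] toM[OF aF] toM[OF bF] by auto
  have int_E: "integrable M (\<lambda>\<omega>. ?K \<omega> A)" "prob A = (\<integral>\<omega>. ?K \<omega> A \<partial>M)" if "A \<in> sets M" for A
    using K.integral_kernel[of "\<lambda>_. 1" A] that by (auto simp: integrable_indicator_iff less_top[symmetric])
  have g: "g (real k) = prob (E k)" for k
    by (simp add: g_def E_def)

  have rec: "AE \<omega> in M. ?K \<omega> (E x) = (\<Sum>y=1..x. W x y \<omega> * ?K \<omega> (E (x - y)))" if "x \<ge> 1" for x
    using K.kernel_panjer_recursion[OF iid X nat N indep assms(24) _ that] assms(25)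
    by (simp add: E_def W_def f_def S_def)
  have g_rec: "g (real x) = (\<Sum>y=1..x. if real (x - y) \<in> R then Dxy x y * g (real (x - y)) else 0)"
    if x: "real x \<in> R - {0}" for x
  proof -
    \<comment> \<open>\<open>W x y\<close> is \<open>F\<close>-measurable, so the kernel weight can
      be replaced by the indicator of \<open>S = x - y\<close>, that is, by \<rho> times
      \<open>g\<close>. If \<open>x - y\<close> is not a value of \<open>S\<close>, the event is
      empty and the term is 0. Integrability is recorded too, for the exchange of sum and
      integral.\<close>
    have summand: "integrable M (\<lambda>\<omega>. W x y \<omega> * ?K \<omega> (E (x - y))) \<and>
        (\<integral>\<omega>. W x y \<omega> * ?K \<omega> (E (x - y)) \<partial>M) =
        (if real (x - y) \<in> R then Dxy x y * g (real (x - y)) else 0)" if y: "y \<in> {1..x}" for y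
    proof (cases "real (x - y) \<in> R")
      case True
      note c = cond_on_value_integral[OF S pos[OF True], of "W x y", folded E_def \<rho>_def]
      have i: "integrable M (\<lambda>\<omega>. W x y \<omega> * indicator (E (x - y)) \<omega>)"
        using assms(26)[OF x y True] c(1) by simp
      show ?thesis
        using K.integral_kernel[OF WF E i] c(2) True by (simp add: Dxy_def g)
    next
      case False
      then have "E (x - y) = {}" by (auto simp: E_def R_def image_iff)
      then show ?thesis using False by simp
    qed
    have "g (real x) = (\<integral>\<omega>. ?K \<omega> (E x) \<partial>M)"
      unfolding g by (rule int_E) simp
    also have "\<dots> = (\<integral>\<omega>. (\<Sum>y=1..x. W x y \<omega> * ?K \<omega> (E (x - y))) \<partial>M)"
      by (rule integral_cong_AE) (use rec x in auto)
    also have "\<dots> = (\<Sum>y=1..x. \<integral>\<omega>. W x y \<omega> * ?K \<omega> (E (x - y)) \<partial>M)"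
      by (rule Bochner_Integration.integral_sum) (use summand in blast)
    also have "\<dots> = (\<Sum>y=1..x. if real (x - y) \<in> R then Dxy x y * g (real (x - y)) else 0)"
      by (rule sum.cong) (use summand in auto)
    finally show ?thesis .
  qed

  have pgf_meas: "(\<lambda>\<omega>. cond_pgf M F N (f 0 \<omega>) \<omega>) \<in> borel_measurable M"
    unfolding cond_pgf_def cprob_def by measurable
  have g_0: "g 0 = (\<integral>\<omega>. cond_pgf M F N (f 0 \<omega>) \<omega> \<partial>M)"
  proof -
    have "AE \<omega> in M. \<forall>n. cprob M F {\<omega>'\<in>space M. N \<omega>' = n} \<omega> = ?K \<omega> {\<omega>'\<in>space M. N \<omega>' = n}"
      unfolding AE_all_countable by (intro allI K.cprob_eq_kernel) measurable
    \<comment> \<open>The constant coefficient of \<open>G ^ n\<close> is the \<open>n\<close>-th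
      power of \<open>f 0\<close>, so at \<open>x = 0\<close> the compound series is the generating
      function.\<close>
    moreover have "AE \<omega> in M. (\<lambda>n. ?K \<omega> {\<omega>'\<in>space M. N \<omega>' = n} *
        fps_nth (Abs_fps (\<lambda>k. f k \<omega>) ^ n) 0) sums ?K \<omega> (E 0)"
      using K.kernel_compound_sum[OF iid X nat N indep, of 0] by (simp add: E_def S_def f_def)
    ultimately have "AE \<omega> in M. ?K \<omega> (E 0) = cond_pgf M F N (f 0 \<omega>) \<omega>"
    proof eventually_elim
      case (elim \<omega>)
      show ?case
        using sums_unique[OF elim(2)] elim(1) by (simp add: cond_pgf_def fps_nth_power_0)
    qed
    then have "(\<integral>\<omega>. ?K \<omega> (E 0) \<partial>M) = (\<integral>\<omega>. cond_pgf M F N (f 0 \<omega>) \<omega> \<partial>M)"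
      by (intro integral_cong_AE pgf_meas) auto
    then show ?thesis
      using int_E(2)[of "E 0"] g[of 0] by simp
  qed

  have special: "g 0 = prob {\<omega>\<in>space M. N \<omega> = 0} \<and>
      (\<forall>x. real x \<in> R - {0} \<longrightarrow> g (real x) =
         (\<Sum>y=1..x. if real (x - y) \<in> R then Dxy0 x y * g (real (x - y)) else 0))"
    if f0: "AE \<omega> in M. f 0 \<omega> = 0"
  proof (intro conjI allI impI)
    let ?A = "{\<omega>\<in>space M. N \<omega> = 0}"
    have A: "?A \<in> sets M" by measurable
    \<comment> \<open>At argument 0 the term \<open>n = 0\<close> alone survives, with
      \<open>0 ^ 0 = 1\<close>.\<close>
    have "AE \<omega> in M. cond_pgf M F N (f 0 \<omega>) \<omega> = ?K \<omega> ?A"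
      using f0 K.cprob_eq_kernel[OF A] by eventually_elim (simp add: cond_pgf_def powser_zero)
    then have "(\<integral>\<omega>. cond_pgf M F N (f 0 \<omega>) \<omega> \<partial>M) = (\<integral>\<omega>. ?K \<omega> ?A \<partial>M)"
      using A by (intro integral_cong_AE pgf_meas) auto
    then show "g 0 = prob ?A"
      using int_E(2)[OF A] g_0 by simp
  next
    fix x assume x: "real x \<in> R - {0}"
    \<comment> \<open>The denominator in \<open>W\<close> is 1 outside an \<open>M\<close>-null set,
      which is also a null set for the uniform measure \<rho>.\<close>
    have "Dxy x y = Dxy0 x y" if R: "real (x - y) \<in> R" for y
    proof -
      have \<rho>: "\<rho> (real (x - y)) = uniform_measure M (E (x - y))"
        unfolding \<rho>_def E_def by (rule cond_on_value_eq_uniform_measure[OF S pos[OF R]])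
      show ?thesis
        unfolding Dxy_def Dxy0_def \<rho>
      proof (rule integral_cong_AE)
        show "AE \<omega> in uniform_measure M (E (x - y)).
            W x y \<omega> = (a (\<Theta> \<omega>) + b (\<Theta> \<omega>) * real y / real x) * f y \<omega>"
          by (rule AE_uniform_measureI) (use f0 in \<open>auto simp: W_def\<close>)
      qed measurable
    qed
    then show "g (real x) = (\<Sum>y=1..x. if real (x - y) \<in> R then Dxy0 x y * g (real (x - y)) else 0)"
      unfolding g_rec[OF x] by (intro sum.cong) auto
  qed

  have cR: "countable R"
    using assms(17) by (rule countable_subset) (simp add: Nats_def)
  have "S \<in> space M \<rightarrow> R" by (auto simp: R_def)
  note cond_on_value_regular_consistent[OF S cR this pos, folded \<rho>_def]
  with g_0 g_rec special show ?thesis by blast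
qed

end
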